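(* Every polyhedron $P$ in $\mathbb{R}^3$ that can be decomposed into a finite number of regular octahedra and regular tetrahedra can be inside-out dissected.
   Context: A decomposition of $P$ into polyhedra means finitely many polyhedra with pairwise disjoint interiors whose union is $P$. An inside-out dissection of a polyhedron $P$ is a decomposition of $P$ into finitely many polyhedra $P_1,\ldots,P_k$ (called pieces) such that (1) the pieces can be rearranged, applying to each piece only a rotation and a translation, to form a polyhedron $P'$ congruent to $P$, and (2) the boundary of $P'$ is composed of internal cuts of $P$, i.e. of (images of) portions of the pieces' boundaries that lay in the interior of $P$ rather than on the boundary of $P$. $P$ can be inside-out dissected if such a decomposition exists. *)

theory Defs
  imports "HOL-Analysis.Analysis"
begin

type_synonym point3 = "real^3"

definition solid_polyhedron :: "point3 set \<Rightarrow> bool" where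
  "solid_polyhedron P \<longleftrightarrow>
     (\<exists>F. finite F \<and> F \<noteq> {} \<and> (\<forall>C\<in>F. polytope C \<and> interior C \<noteq> {}) \<and> P = \<Union>F)"

definition decomposition :: "point3 set \<Rightarrow> nat \<Rightarrow> (nat \<Rightarrow> point3 set) \<Rightarrow> bool" where
  "decomposition P k Q \<longleftrightarrow>
     (\<forall>i<k. solid_polyhedron (Q i)) \<and>
     (\<forall>i<k. \<forall>j<k. i \<noteq> j \<longrightarrow> interior (Q i) \<inter> interior (Q j) = {}) \<and>
     (\<Union>i<k. Q i) = P"

definition regular_tetrahedron :: "point3 set \<Rightarrow> bool" where
  "regular_tetrahedron T \<longleftrightarrow>
     (\<exists>a b c d s. s > 0 \<and> T = convex hull {a, b, c, d} \<and>
        dist a b = s \<and> dist a c = s \<and> dist a d = s \<and>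
        dist b c = s \<and> dist b d = s \<and> dist c d = s)"

definition regular_octahedron :: "point3 set \<Rightarrow> bool" where
  "regular_octahedron R \<longleftrightarrow>
     (\<exists>m u v w. norm u > 0 \<and> norm v = norm u \<and> norm w = norm u \<and>
        u \<bullet> v = 0 \<and> u \<bullet> w = 0 \<and> v \<bullet> w = 0 \<and>
        R = convex hull {m + u, m - u, m + v, m - v, m + w, m - w})"

definition rigid_motion :: "(point3 \<Rightarrow> point3) \<Rightarrow> bool" where
  "rigid_motion g \<longleftrightarrow>
     (\<exists>A b. orthogonal_matrix A \<and> det A = 1 \<and> g = (\<lambda>x. A *v x + b))"

definition congruent :: "point3 set \<Rightarrow> point3 set \<Rightarrow> bool" where
  "congruent X Y \<longleftrightarrow> (\<exists>f. (\<forall>x y. dist (f x) (f y) = dist x y) \<and> f ` X = Y)"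

definition inside_out_dissectable :: "point3 set \<Rightarrow> bool" where
  "inside_out_dissectable P \<longleftrightarrow>
     (\<exists>k Q g. decomposition P k Q \<and> (\<forall>i<k. rigid_motion (g i)) \<and>
        (\<forall>i<k. \<forall>j<k. i \<noteq> j \<longrightarrow> interior (g i ` Q i) \<inter> interior (g j ` Q j) = {}) \<and>
        congruent (\<Union>i<k. g i ` Q i) P \<and>
        frontier (\<Union>i<k. g i ` Q i) \<subseteq>
          closure (\<Union>i<k. g i ` (frontier (Q i) \<inter> interior P)))"

end

theory Submission
  imports Defs
begin

text \<open>
  It suffices to dissect each tetrahedron and octahedron in place: a boundary point of the whole
  is a boundary point of one of them, and cuts interior to a part are interior to the whole.

  Both solids are cut along the tetrahedral-octahedral honeycomb: the octahedron at edge ratio 2,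
  into 6 octahedra and 8 tetrahedra, the tetrahedron at edge ratio 4, into 24 tetrahedra and 10
  octahedra.  Almost every cell has a rotational symmetry that carries cut facets onto its outer
  facets: a half turn for the cells of the big octahedron and for the edge tetrahedra of the big
  tetrahedron, a quarter turn for the octahedra of the big tetrahedron.  The exceptions are the four
  corner tetrahedra, with three outer facets each; they trade places, by translation, with the four
  tetrahedra in the middle of the faces, whose only outer facet is parallel to the cut facet of the
  opposite corner.
\<close>

section \<open>Dissections that rearrange a set in place\<close>

text \<open>The rearranged pieces fill \<open>X\<close> itself rather than a congruent copy, so that
  dissections of the parts of a decomposition fit side by side. A set of pieces paired with motions
  makes joining them a plain union.\<close>

definition dissects :: "(point3 set \<times> (point3 \<Rightarrow> point3)) set \<Rightarrow> point3 set \<Rightarrow> bool" where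
  "dissects D X \<longleftrightarrow>
     finite D \<and>
     (\<forall>d\<in>D. solid_polyhedron (fst d) \<and> rigid_motion (snd d)) \<and>
     (\<forall>d\<in>D. \<forall>e\<in>D. d \<noteq> e \<longrightarrow> interior (fst d) \<inter> interior (fst e) = {} \<and>
        interior (snd d ` fst d) \<inter> interior (snd e ` fst e) = {}) \<and>
     (\<Union>d\<in>D. fst d) = X \<and> (\<Union>d\<in>D. snd d ` fst d) = X \<and>
     frontier X \<subseteq> closure (\<Union>d\<in>D. snd d ` (frontier (fst d) \<inter> interior X))"

lemma dissectsD:
  assumes "dissects D X"
  shows "finite D" and "d \<in> D \<Longrightarrow> solid_polyhedron (fst d)" and "d \<in> D \<Longrightarrow> rigid_motion (snd d)"
    and "d \<in> D \<Longrightarrow> e \<in> D \<Longrightarrow> d \<noteq> e \<Longrightarrow> interior (fst d) \<inter> interior (fst e) = {}"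
    and "d \<in> D \<Longrightarrow> e \<in> D \<Longrightarrow> d \<noteq> e \<Longrightarrow>
           interior (snd d ` fst d) \<inter> interior (snd e ` fst e) = {}"
    and "(\<Union>d\<in>D. fst d) = X" and "(\<Union>d\<in>D. snd d ` fst d) = X"
    and "frontier X \<subseteq> closure (\<Union>d\<in>D. snd d ` (frontier (fst d) \<inter> interior X))"
    and "d \<in> D \<Longrightarrow> fst d \<subseteq> X" and "d \<in> D \<Longrightarrow> snd d ` fst d \<subseteq> X"
proof -
  show U: "(\<Union>d\<in>D. fst d) = X" "(\<Union>d\<in>D. snd d ` fst d) = X"
    using assms unfolding dissects_def by simp_all
  show "d \<in> D \<Longrightarrow> fst d \<subseteq> X" "d \<in> D \<Longrightarrow> snd d ` fst d \<subseteq> X"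
    using U by blast+
qed (use assms in \<open>auto simp: dissects_def\<close>)

text \<open>The rearranged pieces fill \<open>P\<close> again, so the identity serves as the
  congruence.\<close>

lemma dissects_imp_inside_out_dissectable:
  assumes "dissects D P"
  shows "inside_out_dissectable P"
proof -
  obtain h where h: "bij_betw h {0..<card D} D"
    using ex_bij_betw_nat_finite dissectsD(1)[OF assms] by blast
  define k where "k = card D"
  have im: "h ` {..<k} = D" and inj: "inj_on h {..<k}"
    using h by (auto simp: bij_betw_def k_def atLeast0LessThan)
  have mem: "h i \<in> D" if "i < k" for i
    using im that by auto
  have neq: "h i \<noteq> h j" if "i < k" "j < k" "i \<noteq> j" for i j
    using inj that by (auto simp: inj_on_def)
  have un: "(\<Union>i<k. F (h i)) = (\<Union>d\<in>D. F d)" for F :: "_ \<Rightarrow> point3 set"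
    unfolding im[symmetric] by simp
  have U: "(\<Union>i<k. (snd (h i)) ` (fst (h i))) = P"
    unfolding un[of "\<lambda>d. snd d ` fst d"] by (rule dissectsD(7)[OF assms])
  have "decomposition P k (\<lambda>i. fst (h i))"
    unfolding decomposition_def un[of fst]
    using dissectsD(2,4,6)[OF assms] mem neq by auto
  moreover have "congruent P P"
    unfolding congruent_def by (rule exI[of _ id]) simp
  moreover have "frontier P \<subseteq> closure (\<Union>i<k. snd (h i) ` (frontier (fst (h i)) \<inter> interior P))"
    unfolding un[of "\<lambda>d. snd d ` (frontier (fst d) \<inter> interior P)"]
    by (rule dissectsD(8)[OF assms])
  ultimately show ?thesis
    unfolding inside_out_dissectable_def
    using dissectsD(3,5)[OF assms] mem neq U
    by (intro exI[of _ k] exI[of _ "\<lambda>i. fst (h i)"] exI[of _ "\<lambda>i. snd (h i)"]) auto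
qed

text \<open>Every piece lies in its own part before and after its motion, so interiors of pieces
  from different parts stay disjoint.\<close>

lemma dissects_decomposition:
  assumes dec: "decomposition P n X" and "\<And>i. i < n \<Longrightarrow> \<exists>D. dissects D (X i)"
  shows "\<exists>D. dissects D P"
proof -
  obtain D where D: "\<And>i. i < n \<Longrightarrow> dissects (D i) (X i)"
    using assms(2) by metis
  have P: "P = (\<Union>i<n. X i)"
    and disj: "\<And>i j. i < n \<Longrightarrow> j < n \<Longrightarrow> i \<noteq> j \<Longrightarrow> interior (X i) \<inter> interior (X j) = {}"
    using dec unfolding decomposition_def by simp_all
  have mono: "interior (X i) \<subseteq> interior P" if "i < n" for i
    using that unfolding P by (intro interior_mono) auto
  define E where "E = (\<Union>i<n. D i)"
  have E: "\<exists>i<n. d \<in> D i" if "d \<in> E" for d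
    using that unfolding E_def by auto
  have sep: "interior (fst d) \<inter> interior (fst e) = {} \<and>
             interior (snd d ` fst d) \<inter> interior (snd e ` fst e) = {}"
    if de: "d \<in> E" "e \<in> E" "d \<noteq> e" for d e
  proof -
    obtain i j where ij: "i < n" "d \<in> D i" "j < n" "e \<in> D j"
      using E de by metis
    show ?thesis
    proof (cases "i = j")
      case True
      then show ?thesis
        using dissectsD(4,5)[OF D] ij \<open>d \<noteq> e\<close> by auto
    next
      case False
      have "interior (fst d) \<subseteq> interior (X i)" "interior (snd d ` fst d) \<subseteq> interior (X i)"
        "interior (fst e) \<subseteq> interior (X j)" "interior (snd e ` fst e) \<subseteq> interior (X j)"
        using dissectsD(9,10)[OF D[OF ij(1)] ij(2)] dissectsD(9,10)[OF D[OF ij(3)] ij(4)]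
        by (auto dest: interior_mono)
      with disj[OF ij(1,3) False] show ?thesis
        by blast
    qed
  qed
  have "frontier P \<subseteq> closure (\<Union>d\<in>E. snd d ` (frontier (fst d) \<inter> interior P))"
  proof
    fix p assume p: "p \<in> frontier P"
    have "closure P \<subseteq> (\<Union>i<n. closure (X i))"
      unfolding P by (intro closure_minimal) (auto intro: closure_subset[THEN subsetD])
    with p obtain i where i: "i < n" "p \<in> closure (X i)"
      unfolding frontier_def by blast
    moreover have "p \<notin> interior (X i)"
      using p mono[OF i(1)] unfolding frontier_def by blast
    ultimately have "p \<in> frontier (X i)"
      unfolding frontier_def by blast
    then have "p \<in> closure (\<Union>d\<in>D i. snd d ` (frontier (fst d) \<inter> interior (X i)))"
      using dissectsD(8)[OF D[OF i(1)]] by blast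
    also have "\<dots> \<subseteq> closure (\<Union>d\<in>E. snd d ` (frontier (fst d) \<inter> interior P))"
      using mono[OF i(1)] i(1) unfolding E_def by (intro closure_mono) blast
    finally show "p \<in> closure (\<Union>d\<in>E. snd d ` (frontier (fst d) \<inter> interior P))" .
  qed
  moreover have "(\<Union>d\<in>E. fst d) = P" "(\<Union>d\<in>E. snd d ` fst d) = P"
    using dissectsD(6,7)[OF D] unfolding E_def P by auto
  moreover have "finite E"
    using dissectsD(1)[OF D] unfolding E_def by auto
  moreover have "solid_polyhedron (fst d) \<and> rigid_motion (snd d)" if "d \<in> E" for d
    using E[OF that] dissectsD(2,3)[OF D] by metis
  ultimately have "dissects E P"
    using sep unfolding dissects_def by simp
  then show ?thesis ..
qed

section \<open>Transport of dissections along similarities\<close>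

lemma rigid_motion_similarity_conj:
  fixes M :: "real^3^3" and b :: point3
  assumes M: "orthogonal_matrix M" and "r \<noteq> 0" and g: "rigid_motion g"
  defines "f \<equiv> \<lambda>x. b + r *\<^sub>R (M *v x)"
  obtains h where "rigid_motion h" and "\<And>x. h (f x) = f (g x)"
proof -
  obtain A t where A: "orthogonal_matrix A" "det A = 1" "g = (\<lambda>x. A *v x + t)"
    using g unfolding rigid_motion_def by blast
  \<comment> \<open>The linear part of the conjugate of \<open>g\<close> by \<open>f\<close>: the
    factor \<open>r\<close> cancels. As \<open>det M\<close> enters squared, the conjugate is a
    proper motion even if \<open>M\<close> reverses orientation.\<close>
  define B where "B = M ** A ** transpose M"
  have "orthogonal_matrix B"
    unfolding B_def using M A(1) by (intro orthogonal_matrix_mul) auto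
  moreover have "det B = 1"
    using det_orthogonal_matrix[OF M] A(2) by (auto simp: B_def det_mul det_transpose)
  moreover define c where "c = b + r *\<^sub>R (M *v t) - B *v b"
  ultimately have "rigid_motion (\<lambda>x. B *v x + c)"
    unfolding rigid_motion_def by blast
  moreover have "B *v f x + c = f (g x)" for x
  proof -
    have "B *v (M *v x) = M *v (A *v (transpose M *v (M *v x)))"
      by (simp add: B_def flip: matrix_vector_mul_assoc)
    also have "transpose M *v (M *v x) = x"
      using M by (simp add: matrix_vector_mul_assoc orthogonal_matrix)
    finally show ?thesis
      by (simp add: f_def c_def A(3) matrix_vector_right_distrib
          matrix_vector_mult_scaleR scaleR_add_right)
  qed
  ultimately show ?thesis
    using that by blast
qed

lemma similarity_image:
  fixes M :: "real^3^3" and b :: point3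
  assumes M: "orthogonal_matrix M" and r: "r \<noteq> 0"
  defines "f \<equiv> \<lambda>x. b + r *\<^sub>R (M *v x)"
  shows "inj f" and "interior (f ` S) = f ` interior S" and "closure (f ` S) = f ` closure S"
    and "frontier (f ` S) = f ` frontier S" and "polytope S \<Longrightarrow> polytope (f ` S)"
    and "convex hull (f ` S) = f ` (convex hull S)"
proof -
  define L where "L = (\<lambda>x. r *\<^sub>R (M *v x))"
  have lin: "linear L"
    unfolding L_def by (intro linear_compose_scale_right matrix_vector_mul_linear)
  have inv: "transpose M *v (M *v x) = x" for x
    using M by (simp add: matrix_vector_mul_assoc orthogonal_matrix)
  have injL: "inj L"
    unfolding L_def using r inv by (auto intro!: injI) metis
  have fL: "f ` S = (+) b ` (L ` S)" for S
    unfolding f_def L_def by auto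
  show injf: "inj f"
    using injL unfolding f_def L_def inj_def by simp
  show int: "interior (f ` S) = f ` interior S" for S
    unfolding fL interior_translation interior_injective_linear_image[OF lin injL] ..
  show cl: "closure (f ` S) = f ` closure S" for S
    unfolding fL closure_translation closure_injective_linear_image[OF lin injL] ..
  show "frontier (f ` S) = f ` frontier S"
    unfolding frontier_def int cl image_set_diff[OF injf] ..
  show "polytope (f ` S)" if "polytope S"
    unfolding fL polytope_translation_eq by (rule polytope_linear_image[OF lin that])
  show "convex hull (f ` S) = f ` (convex hull S)"
    unfolding fL convex_hull_translation convex_hull_linear_image[OF lin] ..
qed

text \<open>Images of the pieces, moved by the conjugated motions, dissect the image. It thus
  suffices to treat one tetrahedron and one octahedron in a convenient position.\<close>

lemma dissects_similarity:
  fixes M :: "real^3^3" and b :: point3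
  assumes D: "dissects D X" and M: "orthogonal_matrix M" and r: "r \<noteq> 0"
  shows "\<exists>D'. dissects D' ((\<lambda>x. b + r *\<^sub>R (M *v x)) ` X)"
proof -
  define f where "f = (\<lambda>x. b + r *\<^sub>R (M *v x))"
  note im = similarity_image[OF M r, where b = b, folded f_def]
  have "\<exists>h. rigid_motion h \<and> (\<forall>x. h (f x) = f (snd d x))" if "d \<in> D" for d
    using rigid_motion_similarity_conj[OF M r dissectsD(3)[OF D that], of b] f_def by metis
  then obtain h where h: "\<And>d. d \<in> D \<Longrightarrow> rigid_motion (h d)"
    "\<And>d x. d \<in> D \<Longrightarrow> h d (f x) = f (snd d x)"
    by metis
  have hf: "h d ` f ` S = f ` snd d ` S" if "d \<in> D" for d S
    using h(2)[OF that] by (simp add: image_image)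
  define E where "E = (\<lambda>d. (f ` fst d, h d)) ` D"
  have solid: "solid_polyhedron (f ` S)" if S: "solid_polyhedron S" for S
  proof -
    obtain F where F: "finite F" "F \<noteq> {}" "\<And>C. C \<in> F \<Longrightarrow> polytope C \<and> interior C \<noteq> {}"
      "S = \<Union>F"
      using S unfolding solid_polyhedron_def by blast
    show ?thesis
      unfolding solid_polyhedron_def
      using F im(2,5) by (intro exI[of _ "(`) f ` F"]) auto
  qed
  have disj: "f ` A \<inter> f ` B = {}" if "A \<inter> B = {}" for A B
    using that im(1) by (simp add: image_Int[symmetric])
  have "interior (f ` fst d) \<inter> interior (f ` fst e) = {} \<and>
        interior (h d ` f ` fst d) \<inter> interior (h e ` f ` fst e) = {}"
    if "d \<in> D" "e \<in> D" "(f ` fst d, h d) \<noteq> (f ` fst e, h e)" for d e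
    using dissectsD(4,5)[OF D that(1,2)] that by (auto simp: hf im(2) intro!: disj)
  moreover have "(\<Union>d\<in>D. f ` fst d) = f ` X"
    using dissectsD(6)[OF D] by auto
  moreover have "(\<Union>d\<in>D. h d ` f ` fst d) = f ` X"
  proof -
    have "(\<Union>d\<in>D. h d ` f ` fst d) = f ` (\<Union>d\<in>D. snd d ` fst d)"
      by (simp add: hf image_UN)
    then show ?thesis
      by (simp add: dissectsD(7)[OF D])
  qed
  moreover have "frontier (f ` X) \<subseteq>
      closure (\<Union>d\<in>D. h d ` (frontier (f ` fst d) \<inter> interior (f ` X)))"
  proof -
    have "(\<Union>d\<in>D. h d ` (frontier (f ` fst d) \<inter> interior (f ` X))) =
          f ` (\<Union>d\<in>D. snd d ` (frontier (fst d) \<inter> interior X))"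
      by (simp add: im(2,4) hf image_Int[OF im(1), symmetric] image_UN)
    then show ?thesis
      using dissectsD(8)[OF D] by (simp add: im(3,4) image_mono)
  qed
  ultimately have "dissects E (f ` X)"
    unfolding dissects_def E_def
    using dissectsD(1,2)[OF D] h(1) solid by (auto simp del: image_image)
  then show ?thesis
    unfolding f_def by blast
qed


section \<open>The tetrahedral-octahedral honeycomb\<close>

text \<open>Four alternate vertices of the cube with coordinates 1 and -1: they are the vertices of
  the model tetrahedron and also its inward facet normals. Together with their negatives they are
  the facet normals of the model octahedron.\<close>

definition facet_normal :: "4 \<Rightarrow> point3" where
  "facet_normal i = (if i = 1 then vector [1, 1, 1] else if i = 2 then vector [1, -1, -1]
     else if i = 3 then vector [-1, 1, -1] else vector [-1, -1, 1])"

text \<open>\<open>lev i\<close> is a barycentric coordinate with respect to the tetrahedron with vertices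
  \<open>facet_normal j\<close>, scaled so that the four coordinates add up to 4.\<close>

definition lev :: "4 \<Rightarrow> point3 \<Rightarrow> real" where
  "lev i x = 1 + facet_normal i \<bullet> x"

lemma lev_simps:
  "lev 1 x = 1 + x$1 + x$2 + x$3" "lev 2 x = 1 + x$1 - x$2 - x$3"
  "lev 3 x = 1 - x$1 + x$2 - x$3" "lev 4 x = 1 - x$1 - x$2 + x$3"
  by (simp_all add: lev_def facet_normal_def inner_vec_def sum_3)

lemma sum_lev: "(\<Sum>i\<in>UNIV. lev i x) = 4"
  by (simp add: sum_4 lev_simps)

text \<open>The normals span the space and add up to 0, so the sum is the only constraint on the
  four levels; the witness solves \<open>lev_simps\<close> for the coordinates.\<close>

lemma ex_lev:
  assumes "(\<Sum>i\<in>UNIV. a i) = 4"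
  shows "\<exists>x. \<forall>i. lev i x = a i"
proof (rule exI)
  show "\<forall>i. lev i (vector [(a 1 + a 2 - a 3 - a 4) / 4, (a 1 - a 2 + a 3 - a 4) / 4,
                       (a 1 - a 2 - a 3 + a 4) / 4]) = a i"
    using assms by (simp add: forall_4 lev_simps sum_4) argo
qed

lemma facet_normal_nonzero: "facet_normal i \<noteq> 0"
proof
  assume "facet_normal i = 0"
  then have "lev i x = 1" for x
    by (simp add: lev_def)
  moreover obtain x where "\<forall>j. lev j x = (if j = i then 4 else 0)"
    using ex_lev[of "\<lambda>j. if j = i then 4 else 0"] by auto
  ultimately show False
    by (metis numeral_eq_one_iff semiring_norm(85) one_eq_numeral_iff)
qed

text \<open>According to whether the entries of \<open>k\<close> add up to 3, 2 or 1, this is a tetrahedron, an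
  octahedron or an inverted tetrahedron.  Its facets lie in the planes \<open>lev i = k i\<close> in the first
  case and in the planes \<open>lev i = k i + 1\<close> in the last; an octahedron has facets of both kinds.\<close>

definition cell :: "(4 \<Rightarrow> int) \<Rightarrow> point3 set" where
  "cell k = {x. \<forall>i. of_int (k i) \<le> lev i x \<and> lev i x \<le> of_int (k i) + 1}"

lemma lev_halfspaces:
  "{x. a \<le> lev i x} = {x. facet_normal i \<bullet> x \<ge> a - 1}"
  "{x. lev i x \<le> a} = {x. facet_normal i \<bullet> x \<le> a - 1}"
  by (auto simp: lev_def)

lemma polyhedron_cell: "polyhedron (cell k)"
proof -
  have "cell k = (\<Inter>i\<in>UNIV. {x. of_int (k i) \<le> lev i x} \<inter> {x. lev i x \<le> of_int (k i) + 1})"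
    by (auto simp: cell_def)
  also have "polyhedron \<dots>"
    unfolding lev_halfspaces
    by (intro polyhedron_Inter) (auto simp: polyhedron_halfspace_le polyhedron_halfspace_ge)
  finally show ?thesis .
qed

lemma bounded_cell: "bounded (cell k)"
proof -
  \<comment> \<open>\<open>B\<close> bounds the sum of the absolute levels on the cell, and each
    coordinate is a quarter of a signed sum of the levels.\<close>
  define B :: real where "B = (\<Sum>i\<in>UNIV. \<bar>of_int (k i)\<bar>) + 4"
  have "norm x \<le> 3 * B" if "x \<in> cell k" for x
  proof -
    have "\<bar>x$1\<bar> \<le> B \<and> \<bar>x$2\<bar> \<le> B \<and> \<bar>x$3\<bar> \<le> B"
      using that unfolding cell_def B_def by (simp add: forall_4 lev_simps sum_4) argo
    moreover have "norm x \<le> (\<Sum>i\<in>UNIV. \<bar>x$i\<bar>)"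
      by (rule norm_le_l1_cart)
    ultimately show ?thesis
      by (simp add: sum_3)
  qed
  then show ?thesis
    unfolding bounded_iff by blast
qed

lemma polytope_cell: "polytope (cell k)"
  using polyhedron_cell bounded_cell polytope_eq_bounded_polyhedron by blast

lemma interior_cell: "interior (cell k) = {x. \<forall>i. of_int (k i) < lev i x \<and> lev i x < of_int (k i) + 1}"
proof -
  define H where "H i = {x. of_int (k i) \<le> lev i x} \<inter> {x. lev i x \<le> of_int (k i) + 1}" for i
  have H: "interior (H i) = {x. of_int (k i) < lev i x \<and> lev i x < of_int (k i) + 1}" for i
    unfolding H_def lev_halfspaces interior_Int interior_halfspace_le[OF facet_normal_nonzero]
      interior_halfspace_ge[OF facet_normal_nonzero]
    by (auto simp: lev_def)
  have "cell k = H 1 \<inter> H 2 \<inter> H 3 \<inter> H 4"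
    by (auto simp: cell_def H_def forall_4)
  then show ?thesis
    by (auto simp: H forall_4)
qed

lemma interior_cell_disjoint:
  assumes "k \<noteq> k'"
  shows "interior (cell k) \<inter> interior (cell k') = {}"
proof -
  obtain i where i: "k i \<noteq> k' i"
    using assms by blast
  have "\<not> (of_int (k i) < y \<and> y < of_int (k i) + 1 \<and> of_int (k' i) < y \<and> y < of_int (k' i) + (1::real))" for y
    using i by linarith
  then show ?thesis
    unfolding interior_cell by blast
qed

lemma frontier_cell:
  assumes "x \<in> cell k" and "lev i x = of_int (k i) \<or> lev i x = of_int (k i) + 1"
  shows "x \<in> frontier (cell k)"
proof -
  have "x \<notin> interior (cell k)"
    using assms(2) by (auto simp: interior_cell intro!: exI[of _ i])
  then show ?thesis
    using assms(1) closure_subset unfolding frontier_def by blast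
qed

lemma solid_cell:
  assumes "(\<Sum>i\<in>UNIV. k i) \<in> {1, 2, 3}"
  shows "solid_polyhedron (cell k)"
proof -
  \<comment> \<open>Raising all four entries by the same \<open>\<delta>\<close> makes them add up
    to 4. Sums 1, 2 and 3 put \<open>\<delta>\<close> strictly between 0 and 1.\<close>
  define \<delta> :: real where "\<delta> = (4 - of_int (\<Sum>i\<in>UNIV. k i)) / 4"
  have \<delta>: "0 < \<delta>" "\<delta> < 1"
    using assms by (auto simp: \<delta>_def simp del: of_int_sum)
  obtain x where "\<forall>i. lev i x = of_int (k i) + \<delta>"
    using ex_lev[of "\<lambda>i. of_int (k i) + \<delta>"] by (auto simp: \<delta>_def sum_4 field_simps)
  then have "x \<in> interior (cell k)"
    using \<delta> by (simp add: interior_cell)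
  then show ?thesis
    unfolding solid_polyhedron_def using polytope_cell by (intro exI[of _ "{cell k}"]) auto
qed

text \<open>The witness is the centre of the facet: the other three levels share the remaining 4
  minus the sum of \<open>k\<close> equally. For sum 1 each share would be 1, as the plane meets an
  inverted tetrahedron only in a vertex.\<close>

lemma lower_facet:
  assumes "(\<Sum>i\<in>UNIV. k i) \<in> {2, 3}"
  shows "\<exists>c\<in>cell k. lev i c = of_int (k i) \<and>
           (\<forall>j. j \<noteq> i \<longrightarrow> of_int (k j) < lev j c \<and> lev j c < of_int (k j) + 1)"
proof -
  define \<delta> :: real where "\<delta> = (4 - of_int (\<Sum>i\<in>UNIV. k i)) / 3"
  have \<delta>: "0 < \<delta>" "\<delta> < 1"
    using assms by (auto simp: \<delta>_def simp del: of_int_sum)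
  define a :: "4 \<Rightarrow> real" where "a = (\<lambda>j. of_int (k j) + (if j = i then 0 else \<delta>))"
  have "(\<Sum>j\<in>UNIV. a j) = of_int (\<Sum>i\<in>UNIV. k i) + 3 * \<delta>"
    using exhaust_4[of i] by (auto simp: a_def sum_4)
  then obtain c where "\<forall>j. lev j c = a j"
    using ex_lev[of a] by (auto simp: \<delta>_def field_simps)
  then show ?thesis
    using \<delta> by (intro bexI[of _ c]) (auto simp: a_def cell_def)
qed

text \<open>The other levels now share 3 minus the sum, which leaves nothing for an upright
  tetrahedron: the plane meets it only in a vertex.\<close>

lemma upper_facet:
  assumes "(\<Sum>i\<in>UNIV. k i) \<in> {1, 2}"
  shows "\<exists>c\<in>cell k. lev i c = of_int (k i) + 1 \<and>
           (\<forall>j. j \<noteq> i \<longrightarrow> of_int (k j) < lev j c \<and> lev j c < of_int (k j) + 1)"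
proof -
  define \<delta> :: real where "\<delta> = (3 - of_int (\<Sum>i\<in>UNIV. k i)) / 3"
  have \<delta>: "0 < \<delta>" "\<delta> < 1"
    using assms by (auto simp: \<delta>_def simp del: of_int_sum)
  define a :: "4 \<Rightarrow> real" where "a = (\<lambda>j. of_int (k j) + (if j = i then 1 else \<delta>))"
  have "(\<Sum>j\<in>UNIV. a j) = of_int (\<Sum>i\<in>UNIV. k i) + 1 + 3 * \<delta>"
    using exhaust_4[of i] by (auto simp: a_def sum_4)
  then obtain c where "\<forall>j. lev j c = a j"
    using ex_lev[of a] by (auto simp: \<delta>_def field_simps)
  then show ?thesis
    using \<delta> by (intro bexI[of _ c]) (auto simp: a_def cell_def)
qed

section \<open>A criterion for dissecting convex unions of cells\<close>

lemma continuous_on_rigid_motion: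
  assumes "rigid_motion g"
  shows "continuous_on UNIV g"
proof -
  obtain A b where "g = (\<lambda>x. A *v x + b)"
    using assms unfolding rigid_motion_def by blast
  then show ?thesis
    using linear_continuous_on[OF matrix_vector_mul_bounded_linear, of UNIV A]
    by (simp add: continuous_on_add)
qed

text \<open>The moved cells are the old ones permuted by the involution \<open>\<sigma>\<close>, so
  only the boundary condition has geometric content. For it, one point \<open>c\<close> of the cell
  that is interior to \<open>X\<close> and in the same facet plane as \<open>q\<close> suffices, by
  convexity.\<close>

lemma honeycomb_dissects:
  fixes g :: "(4 \<Rightarrow> int) \<Rightarrow> point3 \<Rightarrow> point3"
  assumes K: "finite K" and total: "\<And>k. k \<in> K \<Longrightarrow> (\<Sum>i\<in>UNIV. k i) \<in> {1, 2, 3}"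
    and rigid: "\<And>k. k \<in> K \<Longrightarrow> rigid_motion (g k)"
    and img: "\<And>k. k \<in> K \<Longrightarrow> g k ` cell k = cell (\<sigma> k)"
    and \<sigma>: "\<And>k. k \<in> K \<Longrightarrow> \<sigma> k \<in> K" "\<And>k. k \<in> K \<Longrightarrow> \<sigma> (\<sigma> k) = k"
    and X: "X = (\<Union>k\<in>K. cell k)" and "convex X"
    and front: "\<And>p. p \<in> frontier X \<Longrightarrow>
      \<exists>k\<in>K. \<exists>q\<in>cell k. \<exists>c\<in>cell k \<inter> interior X. \<exists>i. p = g k q \<and>
        (lev i q = of_int (k i) \<and> lev i c = of_int (k i) \<or>
         lev i q = of_int (k i) + 1 \<and> lev i c = of_int (k i) + 1)"
  shows "\<exists>D. dissects D X"
proof -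
  define D where "D = (\<lambda>k. (cell k, g k)) ` K"
  have "interior (cell k) \<inter> interior (cell l) = {} \<and>
        interior (g k ` cell k) \<inter> interior (g l ` cell l) = {}"
    if "k \<in> K" "l \<in> K" "k \<noteq> l" for k l
  proof -
    have "\<sigma> k \<noteq> \<sigma> l"
      using that \<sigma>(2) by metis
    then show ?thesis
      unfolding img[OF that(1)] img[OF that(2)] using that(3) interior_cell_disjoint by simp
  qed
  moreover have "(\<Union>k\<in>K. g k ` cell k) = X"
  proof -
    have "\<sigma> ` K = K"
    proof (intro equalityI subsetI)
      show "k \<in> \<sigma> ` K" if "k \<in> K" for k
        using imageI[OF \<sigma>(1)[OF that], of \<sigma>] \<sigma>(2)[OF that] by simp
    qed (use \<sigma>(1) in auto)
    have "(\<Union>k\<in>K. g k ` cell k) = (\<Union>k\<in>\<sigma> ` K. cell k)"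
      by (simp add: img)
    then show ?thesis
      unfolding \<open>\<sigma> ` K = K\<close> X .
  qed
  moreover have "p \<in> closure (\<Union>k\<in>K. g k ` (frontier (cell k) \<inter> interior X))"
    if pX: "p \<in> frontier X" for p
  proof -
    obtain k q c i where k: "k \<in> K" and q: "q \<in> cell k" and c: "c \<in> cell k" "c \<in> interior X"
      and p: "p = g k q" and i: "lev i q = of_int (k i) \<and> lev i c = of_int (k i) \<or>
         lev i q = of_int (k i) + 1 \<and> lev i c = of_int (k i) + 1"
      using front[OF pX] by auto
    let ?S = "frontier (cell k) \<inter> interior X"
    have c_S: "c \<in> ?S"
      using frontier_cell[of c k i] c i by blast
    \<comment> \<open>The segment stays in the facet plane, hence on the frontier of the cell, and
      convexity keeps it in the interior of \<open>X\<close> up to the endpoint \<open>q\<close>. So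
      \<open>q\<close> is a limit of cut points.\<close>
    have seg: "open_segment c q \<subseteq> ?S"
    proof
      fix y assume y: "y \<in> open_segment c q"
      have "convex (cell k)"
        by (rule polyhedron_imp_convex[OF polyhedron_cell])
      then have "y \<in> cell k"
        using y c q by (meson closed_segment_subset open_closed_segment subsetD)
      moreover have "lev i y = lev i q"
      proof -
        obtain u where u: "y = (1 - u) *\<^sub>R c + u *\<^sub>R q"
          using y by (auto simp: in_segment)
        have "lev i y = (1 - u) * lev i c + u * lev i q"
          unfolding u lev_def inner_add_right inner_scaleR_right by (simp add: algebra_simps)
        also have "lev i c = lev i q"
          using i by auto
        finally show ?thesis
          by (simp add: algebra_simps)
      qed
      ultimately have "y \<in> frontier (cell k)"
        using frontier_cell[of y k i] i by auto
      moreover have "q \<in> X"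
        using k q unfolding X by blast
      then have "q \<in> closure X"
        using closure_subset by (rule rev_subsetD)
      then have "y \<in> interior X"
        using in_interior_closure_convex_segment[OF \<open>convex X\<close> c(2)] y by blast
      ultimately show "y \<in> ?S"
        by blast
    qed
    have "q \<in> closure ?S"
    proof (cases "c = q")
      case True
      then show ?thesis
        using subsetD[OF closure_subset c_S] by simp
    next
      case False
      then have "q \<in> closure (open_segment c q)"
        by simp
      then show ?thesis
        using subsetD[OF closure_mono[OF seg]] by simp
    qed
    moreover have "continuous_on (closure ?S) (g k)"
      using continuous_on_rigid_motion[OF rigid[OF k]] by (rule continuous_on_subset) simp
    then have "g k ` closure ?S \<subseteq> closure (g k ` ?S)"
      by (intro image_closure_subset) (auto simp: closure_subset)
    ultimately have "p \<in> closure (g k ` ?S)"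
      unfolding p by (metis imageI subsetD)
    also have "\<dots> \<subseteq> closure (\<Union>k\<in>K. g k ` (frontier (cell k) \<inter> interior X))"
      using k by (intro closure_mono) blast
    finally show ?thesis .
  qed
  ultimately have "dissects D X"
    using K rigid solid_cell[OF total] unfolding dissects_def D_def
    by (simp add: X[symmetric] subset_iff) blast
  then show ?thesis ..
qed

section \<open>Motions permuting the cells\<close>

lemma rigid_motions:
  "rigid_motion (\<lambda>x. x + t)"
  "rigid_motion (\<lambda>x. vector [a - x$1, b - x$2, x$3])"
  "rigid_motion (\<lambda>x. vector [a - x$1, x$2, b - x$3])"
  "rigid_motion (\<lambda>x. vector [a - x$2, b + x$1, x$3])"
proof -
  have rot: "rigid_motion g"
    if "orthogonal_matrix A" "det A = 1" "\<And>x. g x = A *v x + c"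
    for g :: "point3 \<Rightarrow> point3" and A c
    using that unfolding rigid_motion_def by blast
  note simps = orthogonal_matrix_def transpose_def matrix_matrix_mult_def mat_def vec_eq_iff
    forall_3 sum_3 det_3 matrix_vector_mult_def
  show "rigid_motion (\<lambda>x. x + t)"
    by (rule rot[of "mat 1" _ t]) (simp_all add: orthogonal_matrix_id)
  show "rigid_motion (\<lambda>x. vector [a - x$1, b - x$2, x$3])"
    by (rule rot[of "vector [vector [-1, 0, 0], vector [0, -1, 0], vector [0, 0, 1]]" _
          "vector [a, b, 0]"]) (simp_all add: simps)
  show "rigid_motion (\<lambda>x. vector [a - x$1, x$2, b - x$3])"
    by (rule rot[of "vector [vector [-1, 0, 0], vector [0, 1, 0], vector [0, 0, -1]]" _
          "vector [a, 0, b]"]) (simp_all add: simps)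
  show "rigid_motion (\<lambda>x. vector [a - x$2, b + x$1, x$3])"
    by (rule rot[of "vector [vector [0, -1, 0], vector [1, 0, 0], vector [0, 0, 1]]" _
          "vector [a, b, 0]"]) (simp_all add: simps)
qed

lemma surj_rigid_motion:
  assumes "rigid_motion g"
  shows "surj g"
proof -
  obtain A b where A: "orthogonal_matrix A" and g: "g = (\<lambda>x. A *v x + b)"
    using assms unfolding rigid_motion_def by blast
  have "g (transpose A *v (y - b)) = y" for y
    using A by (simp add: g matrix_vector_mul_assoc orthogonal_matrix_def del: transpose_matrix_vector)
  then show ?thesis
    by (metis surj_def)
qed

lemma image_cell:
  assumes "rigid_motion g" and "\<And>x. x \<in> cell k \<longleftrightarrow> g x \<in> cell k'"
  shows "g ` cell k = cell k'"
  using assms surj_rigid_motion[OF assms(1)] by (auto simp: image_iff) (metis surj_def)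

text \<open>The centroid of the cell, where every \<open>lev i\<close> exceeds \<open>k i\<close> by
  the same amount, 1 minus a quarter of the sum of \<open>k\<close>.\<close>

definition centre :: "(4 \<Rightarrow> int) \<Rightarrow> point3" where
  "centre k = vector [of_int (k 1 + k 2 - k 3 - k 4) / 4, of_int (k 1 - k 2 + k 3 - k 4) / 4,
     of_int (k 1 - k 2 - k 3 + k 4) / 4]"

text \<open>The axis depends on \<open>k\<close> so that zero and nonzero entries are interchanged when there are two
  of each.\<close>

definition half_turn :: "(4 \<Rightarrow> int) \<Rightarrow> point3 \<Rightarrow> point3" where
  "half_turn k = (if (k 1 = 0) = (k 4 = 0)
     then (\<lambda>x. vector [2 * centre k $ 1 - x$1, x$2, 2 * centre k $ 3 - x$3])
     else (\<lambda>x. vector [2 * centre k $ 1 - x$1, 2 * centre k $ 2 - x$2, x$3]))"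

text \<open>The permutation of the facet directions induced by \<open>half_turn k\<close>; it fixes
  no index.\<close>

definition half_turn_index :: "(4 \<Rightarrow> int) \<Rightarrow> 4 \<Rightarrow> 4" where
  "half_turn_index k i = (if (k 1 = 0) = (k 4 = 0)
     then (if i = 1 then 3 else if i = 2 then 4 else if i = 3 then 1 else 2)
     else (if i = 1 then 4 else if i = 2 then 3 else if i = 3 then 2 else 1))"

text \<open>The axis passes through the centroid, where the levels relative to \<open>k\<close> all
  agree, so the rotation permutes relative levels just as it permutes the normals.\<close>

lemma lev_half_turn:
  "lev i (half_turn k x) - of_int (k i) =
   lev (half_turn_index k i) x - of_int (k (half_turn_index k i))"
  using exhaust_4[of i]
  by (auto simp: half_turn_def half_turn_index_def lev_simps centre_def) argo+

lemma rigid_half_turn: "rigid_motion (half_turn k)"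
  unfolding half_turn_def using rigid_motions by auto

lemma half_turn_cell: "half_turn k ` cell k = cell k"
proof (rule image_cell[OF rigid_half_turn])
  have eq: "x \<in> cell k \<longleftrightarrow> (\<forall>i. 0 \<le> lev i x - of_int (k i) \<and> lev i x - of_int (k i) \<le> 1)" for x
    by (auto simp: cell_def algebra_simps)
  show "x \<in> cell k \<longleftrightarrow> half_turn k x \<in> cell k" for x
    unfolding eq lev_half_turn by (auto simp: forall_4 half_turn_index_def)
qed

text \<open>Only the rearrangements of (2, 1, 0, 0) satisfy the assumptions: the tetrahedra along
  the edges. The axis was chosen to interchange the two zeros with the other two entries.\<close>

lemma half_turn_index:
  assumes "\<And>i. 0 \<le> k i"
    and "\<And>i. k i \<le> 2" and "\<not> (\<forall>i. k i \<le> 1)" and "(\<Sum>i\<in>UNIV. k i) = 3"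
  shows "k (half_turn_index k i) = 0 \<longleftrightarrow> k i \<noteq> 0"
proof -
  have "0 \<le> k 1" "0 \<le> k 2" "0 \<le> k 3" "0 \<le> k 4" "k 1 \<le> 2" "k 2 \<le> 2" "k 3 \<le> 2" "k 4 \<le> 2"
    using assms(1,2) by auto
  with assms(3,4) show ?thesis
    using exhaust_4[of i] unfolding forall_4 sum_4 half_turn_index_def
    by (elim disjE) (simp_all, presburger+)
qed

section \<open>Quarter turns of octahedra and translations of cells\<close>

definition quarter_turn :: "(4 \<Rightarrow> int) \<Rightarrow> point3 \<Rightarrow> point3" where
  "quarter_turn k = (\<lambda>x. vector [centre k $ 1 + centre k $ 2 - x$2, centre k $ 2 - centre k $ 1 + x$1, x$3])"

definition quarter_turn_index :: "4 \<Rightarrow> 4" where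
  "quarter_turn_index i = (if i = 1 then 3 else if i = 2 then 1 else if i = 3 then 4 else 2)"

text \<open>The rotation carries each normal to the negative of another, and relative levels are 1/2
  at the centre of an octahedron. Hence \<open>y\<close> becomes \<open>1 - y\<close>, and lower and
  upper facets are exchanged.\<close>

lemma lev_quarter_turn:
  assumes "(\<Sum>i\<in>UNIV. k i) = 2"
  shows "lev i (quarter_turn k x) - of_int (k i) =
    1 - (lev (quarter_turn_index i) x - of_int (k (quarter_turn_index i)))"
proof -
  have "k 1 = 2 - k 2 - k 3 - k 4"
    using assms by (simp add: sum_4)
  then have "real_of_int (k 1) = 2 - of_int (k 2) - of_int (k 3) - of_int (k 4)"
    by simp
  then show ?thesis
    using exhaust_4[of i]
    by (auto simp: quarter_turn_def quarter_turn_index_def lev_simps centre_def) argo+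
qed

lemma rigid_quarter_turn: "rigid_motion (quarter_turn k)"
  unfolding quarter_turn_def by (rule rigid_motions)

lemma quarter_turn_cell:
  assumes "(\<Sum>i\<in>UNIV. k i) = 2"
  shows "quarter_turn k ` cell k = cell k"
proof (rule image_cell[OF rigid_quarter_turn])
  have eq: "x \<in> cell k \<longleftrightarrow> (\<forall>i. 0 \<le> lev i x - of_int (k i) \<and> lev i x - of_int (k i) \<le> 1)" for x
    by (auto simp: cell_def algebra_simps)
  show "x \<in> cell k \<longleftrightarrow> quarter_turn k x \<in> cell k" for x
    unfolding eq lev_quarter_turn[OF assms] by (auto simp: forall_4 quarter_turn_index_def)
qed

lemma lev_translate:
  "lev i (x - s *\<^sub>R centre k) = lev i x - s * (of_int (k i) - of_int (\<Sum>j\<in>UNIV. k j) / 4)"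
  using exhaust_4[of i] by (auto simp: lev_simps centre_def sum_4) argo+

lemma translate_cell:
  assumes "\<And>i. s * (of_int (k i) - of_int (\<Sum>j\<in>UNIV. k j) / 4) = of_int (k i - k' i)"
  shows "(\<lambda>x. x - s *\<^sub>R centre k) ` cell k = cell k'"
proof (rule image_cell)
  show "rigid_motion (\<lambda>x. x - s *\<^sub>R centre k)"
    using rigid_motions(1)[of "- (s *\<^sub>R centre k)"] by simp
  show "x \<in> cell k \<longleftrightarrow> x - s *\<^sub>R centre k \<in> cell k'" for x
    unfolding cell_def mem_Collect_eq lev_translate assms
    by (intro iff_allI) (auto simp: algebra_simps)
qed

section \<open>The octahedron\<close>

text \<open>Sums 0 and 4 are left out because those cells shrink to the single point where all
  levels are 1. What remains is 4 upright tetrahedra, 6 octahedra and 4 inverted tetrahedra.\<close>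

definition octa_cells :: "(4 \<Rightarrow> int) set" where
  "octa_cells = {k. (\<forall>i. k i \<in> {0, 1}) \<and> (\<Sum>i\<in>UNIV. k i) \<in> {1, 2, 3}}"

definition octa :: "point3 set" where
  "octa = {x. \<forall>i. 0 \<le> lev i x \<and> lev i x \<le> 2}"

lemma finite_int_valued: "finite {k :: 4 \<Rightarrow> int. \<forall>i. k i \<in> {0..n}}"
proof -
  have "{k :: 4 \<Rightarrow> int. \<forall>i. k i \<in> {0..n}} = Pi\<^sub>E UNIV (\<lambda>_. {0..n})"
    by (auto simp: PiE_def Pi_def)
  then show ?thesis
    by (simp add: finite_PiE)
qed

text \<open>The extra condition on the sum selects, among the cells that contain a boundary point, one
  that has a facet there.\<close>

lemma octa_cover_lower:
  assumes "x \<in> octa"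
  shows "\<exists>k\<in>octa_cells. x \<in> cell k \<and> ((\<exists>i. lev i x = 0) \<longrightarrow> (\<Sum>i\<in>UNIV. k i) \<in> {2, 3})"
proof (cases "\<forall>i. lev i x \<ge> 1")
  case True
  \<comment> \<open>Here \<open>x\<close> is the centre of the octahedron, which lies in every cell;
    the index chosen below has sum 3.\<close>
  then have "lev i x = 1" for i
    using exhaust_4[of i] sum_lev[of x] by (auto simp: forall_4 sum_4)
  then show ?thesis
    by (intro bexI[of _ "\<lambda>i. if i = 1 then 0 else 1"]) (auto simp: octa_cells_def cell_def sum_4)
next
  case False
  define k :: "4 \<Rightarrow> int" where "k i = (if lev i x \<ge> 1 then 1 else 0)" for i
  have "x \<in> cell k"
    using assms by (auto simp: octa_def cell_def k_def)
  moreover have "(\<Sum>i\<in>UNIV. k i) \<in> {1, 2, 3}"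
    using False sum_lev[of x] by (auto simp: k_def sum_4 forall_4)
  \<comment> \<open>The other three levels add up to 4 and none exceeds 2, so at least two of them
    reach the threshold 1.\<close>
  moreover have "(\<Sum>i\<in>UNIV. k i) \<in> {2, 3}" if "lev i x = 0" for i
    using assms sum_lev[of x] that exhaust_4[of i] by (auto simp: octa_def k_def sum_4 forall_4)
  ultimately show ?thesis
    by (intro bexI[of _ k]) (auto simp: octa_cells_def k_def)
qed

text \<open>The threshold 1 is strict this time: next to a level 2 the others add up to 2, so at
  most one exceeds 1.\<close>

lemma octa_cover_upper:
  assumes "x \<in> octa" "lev i x = 2"
  shows "\<exists>k\<in>octa_cells. x \<in> cell k \<and> k i = 1 \<and> (\<Sum>i\<in>UNIV. k i) \<in> {1, 2}"
proof -
  define k :: "4 \<Rightarrow> int" where "k i = (if lev i x > 1 then 1 else 0)" for i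
  have "x \<in> cell k"
    using assms by (auto simp: octa_def cell_def k_def)
  moreover have "(\<Sum>i\<in>UNIV. k i) \<in> {1, 2}"
    using assms exhaust_4[of i] sum_lev[of x] by (auto simp: octa_def k_def sum_4 forall_4)
  ultimately show ?thesis
    using assms(2) by (intro bexI[of _ k]) (auto simp: octa_cells_def k_def)
qed

lemma octa_eq: "octa = (\<Union>k\<in>octa_cells. cell k)"
proof
  show "octa \<subseteq> (\<Union>k\<in>octa_cells. cell k)"
    using octa_cover_lower by blast
  show "(\<Union>k\<in>octa_cells. cell k) \<subseteq> octa"
  proof
    fix x assume "x \<in> (\<Union>k\<in>octa_cells. cell k)"
    then obtain k where k: "\<And>i. k i \<in> {0, 1}" "\<And>i. of_int (k i) \<le> lev i x \<and> lev i x \<le> of_int (k i) + 1"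
      unfolding octa_cells_def cell_def by auto
    have "0 \<le> lev i x \<and> lev i x \<le> 2" for i
      using k(1)[of i] k(2)[of i] by auto
    then show "x \<in> octa"
      by (simp add: octa_def)
  qed
qed

lemma continuous_lev: "continuous_on S (lev i)"
  unfolding lev_def by (intro continuous_intros)

lemma convex_octa: "convex octa"
proof -
  have octa: "octa = (\<Inter>i. {x. 0 \<le> lev i x} \<inter> {x. lev i x \<le> 2})"
    by (auto simp: octa_def)
  show ?thesis
    unfolding octa lev_halfspaces
    by (intro convex_INT convex_Int convex_halfspace_le convex_halfspace_ge)
qed

lemma interior_octa: "{x. \<forall>i. 0 < lev i x \<and> lev i x < 2} \<subseteq> interior octa"
proof (rule interior_maximal)
  have "{x. \<forall>i. 0 < lev i x \<and> lev i x < 2} = (\<Inter>i. {x. 0 < lev i x} \<inter> {x. lev i x < 2})"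
    by auto
  then show "open {x. \<forall>i. 0 < lev i x \<and> lev i x < 2}"
    by (auto intro!: open_INT open_Int open_Collect_less continuous_lev continuous_intros)
  show "{x. \<forall>i. 0 < lev i x \<and> lev i x < 2} \<subseteq> octa"
    by (auto simp: octa_def less_imp_le)
qed

text \<open>The cuts lie in the planes \<open>lev j = 1\<close>. A lower facet is outer where the
  entry of \<open>k\<close> is 0, an upper one where it is 1; the half turn brings to each outer
  facet one of the same kind with the other entry, which is a cut.\<close>

lemma octa_dissects: "\<exists>D. dissects D octa"
proof (rule honeycomb_dissects[where K = octa_cells and g = half_turn and \<sigma> = "\<lambda>k. k"])
  show "finite octa_cells"
  proof (rule finite_subset[OF _ finite_int_valued[of 1]], safe)
    fix k i assume "k \<in> octa_cells"
    then have "k i \<in> {0, 1}"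
      by (simp add: octa_cells_def)
    then show "k i \<in> {0..1}"
      by auto
  qed
  fix p assume p: "p \<in> frontier octa"
  have "closed octa"
    unfolding octa_eq using \<open>finite octa_cells\<close> polytope_imp_closed[OF polytope_cell] by blast
  then have p_octa: "p \<in> octa"
    using p frontier_subset_closed by blast
  have "p \<notin> interior octa"
    using p by (simp add: frontier_def)
  then obtain i where "\<not> (0 < lev i p \<and> lev i p < 2)"
    using interior_octa by blast
  moreover have "0 \<le> lev i p \<and> lev i p \<le> 2"
    using p_octa by (simp add: octa_def)
  ultimately have i: "lev i p = 0 \<or> lev i p = 2"
    by linarith
  show "\<exists>k\<in>octa_cells. \<exists>q\<in>cell k. \<exists>c\<in>cell k \<inter> interior octa. \<exists>i. p = half_turn k q \<and>
      (lev i q = of_int (k i) \<and> lev i c = of_int (k i) \<or>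
       lev i q = of_int (k i) + 1 \<and> lev i c = of_int (k i) + 1)"
    using i
  proof
    assume i: "lev i p = 0"
    obtain k where k: "k \<in> octa_cells" "p \<in> cell k" "(\<Sum>i\<in>UNIV. k i) \<in> {2, 3}"
      using octa_cover_lower[OF p_octa] i by blast
    have k01: "k j = 0 \<or> k j = 1" for j
      using k(1) by (auto simp: octa_cells_def)
    have "of_int (k i) \<le> lev i p"
      using k(2) by (auto simp: cell_def)
    then have ki: "k i = 0"
      using k01[of i] i by auto
    obtain q where q: "q \<in> cell k" "p = half_turn k q"
      using k(2) half_turn_cell[of k] by blast
    let ?j = "half_turn_index k i"
    \<comment> \<open>If the sum is 3, \<open>i\<close> is the only zero entry and \<open>?j\<close>
      differs from it; if it is 2, the axis was chosen to interchange zeros and ones.\<close>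
    have "k ?j = 1"
      using k01[of 1] k01[of 2] k01[of 3] k01[of 4] k(3) ki exhaust_4[of i]
      unfolding half_turn_index_def sum_4 by auto
    moreover have "lev ?j q = of_int (k ?j)"
      using lev_half_turn[of i k q] i ki q(2) by simp
    moreover obtain c where c: "c \<in> cell k" "lev ?j c = of_int (k ?j)"
      "\<And>j. j \<noteq> ?j \<Longrightarrow> of_int (k j) < lev j c \<and> lev j c < of_int (k j) + 1"
      using lower_facet[OF k(3)] by blast
    moreover have "0 < lev j c \<and> lev j c < 2" for j
      using c(2) c(3)[of j] k01[of j] \<open>k ?j = 1\<close> by (cases "j = ?j") auto
    ultimately show ?thesis
      using k(1) q interior_octa by blast
  next
    assume i: "lev i p = 2"
    obtain k where k: "k \<in> octa_cells" "p \<in> cell k" "k i = 1" "(\<Sum>i\<in>UNIV. k i) \<in> {1, 2}"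
      using octa_cover_upper[OF p_octa i] by blast
    have k01: "k j = 0 \<or> k j = 1" for j
      using k(1) by (auto simp: octa_cells_def)
    obtain q where q: "q \<in> cell k" "p = half_turn k q"
      using k(2) half_turn_cell[of k] by blast
    let ?j = "half_turn_index k i"
    have "k ?j = 0"
      using k01[of 1] k01[of 2] k01[of 3] k01[of 4] k(3,4) exhaust_4[of i]
      unfolding half_turn_index_def sum_4 by auto
    moreover have "lev ?j q = of_int (k ?j) + 1"
      using lev_half_turn[of i k q] i k(3) q(2) by simp
    moreover obtain c where c: "c \<in> cell k" "lev ?j c = of_int (k ?j) + 1"
      "\<And>j. j \<noteq> ?j \<Longrightarrow> of_int (k j) < lev j c \<and> lev j c < of_int (k j) + 1"
      using upper_facet[OF k(4)] by blast
    moreover have "0 < lev j c \<and> lev j c < 2" for j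
      using c(2) c(3)[of j] k01[of j] \<open>k ?j = 0\<close> by (cases "j = ?j") auto
    ultimately show ?thesis
      using k(1) q interior_octa by blast
  qed
qed (simp_all add: octa_eq[symmetric] convex_octa rigid_half_turn half_turn_cell,
    simp add: octa_cells_def)

section \<open>The tetrahedron\<close>

text \<open>The sum also bounds the entries by 3. Sum 3 gives 20 upright tetrahedra, sum 2 gives 10
  octahedra and sum 1 gives 4 inverted tetrahedra.\<close>

definition tetra_cells :: "(4 \<Rightarrow> int) set" where
  "tetra_cells = {k. (\<forall>i. 0 \<le> k i) \<and> (\<Sum>i\<in>UNIV. k i) \<in> {1, 2, 3}}"

definition tetra :: "point3 set" where
  "tetra = {x. \<forall>i. 0 \<le> lev i x}"

text \<open>The integer parts of the levels index a cell around \<open>x\<close>, except at a vertex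
  of the honeycomb, where they add up to 4.\<close>

lemma tetra_cover:
  assumes "x \<in> tetra"
  shows "\<exists>k\<in>tetra_cells. x \<in> cell k \<and> ((\<exists>i. lev i x = 0) \<longrightarrow> (\<Sum>i\<in>UNIV. k i) \<in> {2, 3})"
proof -
  define m where "m i = \<lfloor>lev i x\<rfloor>" for i
  have m: "of_int (m i) \<le> lev i x" "lev i x < of_int (m i) + 1" for i
    by (auto simp: m_def)
  have m0: "0 \<le> m i" for i
    using assms by (auto simp: tetra_def m_def)
  have "real_of_int (m 1 + m 2 + m 3 + m 4) \<le> 4" "4 < real_of_int (m 1 + m 2 + m 3 + m 4 + 4)"
    using m[of 1] m[of 2] m[of 3] m[of 4] sum_lev[of x] by (auto simp: sum_4)
  then have m_sum: "m 1 + m 2 + m 3 + m 4 \<le> 4" "0 < m 1 + m 2 + m 3 + m 4"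
    by linarith+
  show ?thesis
  proof (cases "m 1 + m 2 + m 3 + m 4 = 4")
    case False
    have "(\<Sum>i\<in>UNIV. m i) \<in> {2, 3}" if i: "lev i x = 0" for i
    proof (rule ccontr)
      \<comment> \<open>With sum 1 the fractional parts would add up to 3, although that of
        \<open>lev i x\<close> is 0 and the other three are below 1.\<close>
      assume "(\<Sum>i\<in>UNIV. m i) \<notin> {2, 3}"
      then have "m 1 + m 2 + m 3 + m 4 = 1"
        using False m_sum by (auto simp: sum_4)
      then have "real_of_int (m 1) + of_int (m 2) + of_int (m 3) + of_int (m 4) = 1"
        by (simp flip: of_int_add)
      moreover have "m i = 0"
        using i by (simp add: m_def)
      ultimately show False
        using m[of 1] m[of 2] m[of 3] m[of 4] sum_lev[of x] exhaust_4[of i] i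
        by (auto simp: sum_4)
    qed
    moreover have "m \<in> tetra_cells"
      using m0 m_sum False by (auto simp: tetra_cells_def sum_4)
    moreover have "x \<in> cell m"
      using m by (auto simp: cell_def less_imp_le)
    ultimately show ?thesis
      by blast
  next
    case True
    then have "real_of_int (m 1) + of_int (m 2) + of_int (m 3) + of_int (m 4) = 4"
      by (simp flip: of_int_add)
    then have eq: "lev i x = of_int (m i)" for i
      using m[of 1] m[of 2] m[of 3] m[of 4] sum_lev[of x] exhaust_4[of i]
      by (auto simp: sum_4)
    obtain j where j: "1 \<le> m j"
      using True by (metis add.right_neutral m0 linorder_not_le int_one_le_iff_zero_less
          zero_neq_numeral order_antisym_conv)
    \<comment> \<open>Lowering one positive entry gives an upright tetrahedron with vertex
      \<open>x\<close>.\<close>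
    define k where "k = m(j := m j - 1)"
    have "(\<Sum>i\<in>UNIV. k i) = 3"
      using True exhaust_4[of j] by (auto simp: k_def sum_4)
    moreover have "0 \<le> k i" for i
      using j m0 by (auto simp: k_def)
    moreover have "x \<in> cell k"
      by (auto simp: cell_def k_def eq)
    ultimately show ?thesis
      by (intro bexI[of _ k]) (auto simp: tetra_cells_def)
  qed
qed

lemma tetra_eq: "tetra = (\<Union>k\<in>tetra_cells. cell k)"
proof
  show "tetra \<subseteq> (\<Union>k\<in>tetra_cells. cell k)"
    using tetra_cover by blast
  show "(\<Union>k\<in>tetra_cells. cell k) \<subseteq> tetra"
  proof
    fix x assume "x \<in> (\<Union>k\<in>tetra_cells. cell k)"
    then obtain k where k: "\<And>i. 0 \<le> k i" "\<And>i. of_int (k i) \<le> lev i x"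
      unfolding tetra_cells_def cell_def by auto
    have "0 \<le> lev i x" for i
      using k(1)[of i] k(2)[of i] by linarith
    then show "x \<in> tetra"
      by (simp add: tetra_def)
  qed
qed

lemma convex_tetra: "convex tetra"
proof -
  have tetra: "tetra = (\<Inter>i. {x. 0 \<le> lev i x})"
    by (auto simp: tetra_def)
  show ?thesis
    unfolding tetra lev_halfspaces by (intro convex_INT convex_halfspace_ge)
qed

lemma interior_tetra: "{x. \<forall>i. 0 < lev i x} \<subseteq> interior tetra"
proof (rule interior_maximal)
  have "{x. \<forall>i. 0 < lev i x} = (\<Inter>i. {x. 0 < lev i x})"
    by auto
  then show "open {x. \<forall>i. 0 < lev i x}"
    by (auto intro!: open_INT open_Collect_less continuous_lev continuous_intros)
  show "{x. \<forall>i. 0 < lev i x} \<subseteq> tetra"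
    by (auto simp: tetra_def less_imp_le)
qed

section \<open>Rearrangement of the cells of the tetrahedron\<close>

definition corner :: "(4 \<Rightarrow> int) \<Rightarrow> bool" where
  "corner k \<longleftrightarrow> (\<exists>i. k i = 3)"

definition mid_face :: "(4 \<Rightarrow> int) \<Rightarrow> bool" where
  "mid_face k \<longleftrightarrow> (\<forall>i. k i \<le> 1) \<and> (\<Sum>i\<in>UNIV. k i) = 3"

text \<open>The arithmetic encodes the exchange of (3, 0, 0, 0) with (0, 1, 1, 1), the middle cell
  of the opposite face, and likewise for the other vertices.\<close>

definition tetra_swap :: "(4 \<Rightarrow> int) \<Rightarrow> 4 \<Rightarrow> int" where
  "tetra_swap k = (if corner k then (\<lambda>i. 1 - k i div 3) else if mid_face k then (\<lambda>i. 3 - 3 * k i) else k)"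

text \<open>The corner at the vertex \<open>facet_normal j\<close> is centred at 3/4 of that vector
  and the middle cell of the opposite face at -1/4 of it. They differ by
  \<open>facet_normal j\<close>, whence the factors 4/3 and 4. Inverted tetrahedra have no outer
  facet and stay in place.\<close>

definition tetra_motion :: "(4 \<Rightarrow> int) \<Rightarrow> point3 \<Rightarrow> point3" where
  "tetra_motion k = (if corner k then (\<lambda>x. x - (4/3) *\<^sub>R centre k)
     else if mid_face k then (\<lambda>x. x - 4 *\<^sub>R centre k)
     else if (\<Sum>i\<in>UNIV. k i) = 3 then half_turn k
     else if (\<Sum>i\<in>UNIV. k i) = 2 then quarter_turn k
     else (\<lambda>x. x))"

lemma corner_cases:
  assumes "k \<in> tetra_cells" "corner k"
  shows "\<exists>j. k = (\<lambda>i. if i = j then 3 else 0)"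
proof -
  obtain j where "k j = 3"
    using assms(2) by (auto simp: corner_def)
  moreover have "0 \<le> k 1" "0 \<le> k 2" "0 \<le> k 3" "0 \<le> k 4" "k 1 + k 2 + k 3 + k 4 \<le> 3"
    using assms(1) by (auto simp: tetra_cells_def sum_4)
  ultimately have "k i = (if i = j then 3 else 0)" for i
    using exhaust_4[of i] exhaust_4[of j] by auto
  then show ?thesis
    by blast
qed

lemma mid_face_cases:
  assumes "k \<in> tetra_cells" "mid_face k"
  shows "\<exists>j. k = (\<lambda>i. if i = j then 0 else 1)"
proof -
  have k: "0 \<le> k 1" "0 \<le> k 2" "0 \<le> k 3" "0 \<le> k 4" "k 1 \<le> 1" "k 2 \<le> 1" "k 3 \<le> 1" "k 4 \<le> 1"
    "k 1 + k 2 + k 3 + k 4 = 3"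
    using assms by (auto simp: tetra_cells_def mid_face_def sum_4)
  then have "k 1 = 0 \<or> k 2 = 0 \<or> k 3 = 0 \<or> k 4 = 0"
    by linarith
  then obtain j where "k j = 0"
    by blast
  then have "k i = (if i = j then 0 else 1)" for i
    using k exhaust_4[of i] exhaust_4[of j] by auto
  then show ?thesis
    by blast
qed

lemma corner_swap:
  "corner (\<lambda>i. if i = j then 3 else 0)" "\<not> corner (\<lambda>i. if i = j then 0 else 1)"
  "mid_face (\<lambda>i. if i = j then 0 else 1)"
  "tetra_swap (\<lambda>i. if i = j then 3 else 0) = (\<lambda>i. if i = j then 0 else 1)"
  "tetra_swap (\<lambda>i. if i = j then 0 else 1) = (\<lambda>i. if i = j then 3 else 0)"
  "(\<lambda>i. if i = j then 3 else 0) \<in> tetra_cells" "(\<lambda>i. if i = j then 0 else 1) \<in> tetra_cells"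
proof -
  show 1: "corner (\<lambda>i. if i = j then 3 else 0)" "\<not> corner (\<lambda>i. if i = j then 0 else 1)"
    "mid_face (\<lambda>i. if i = j then 0 else 1)"
    using exhaust_4[of j] by (auto simp: corner_def mid_face_def sum_4)
  show "tetra_swap (\<lambda>i. if i = j then 3 else 0) = (\<lambda>i. if i = j then 0 else 1)"
    "tetra_swap (\<lambda>i. if i = j then 0 else 1) = (\<lambda>i. if i = j then 3 else 0)"
    using 1 by (auto simp: tetra_swap_def)
  show "(\<lambda>i. if i = j then 3 else 0) \<in> tetra_cells" "(\<lambda>i. if i = j then 0 else 1) \<in> tetra_cells"
    using exhaust_4[of j] by (auto simp: tetra_cells_def sum_4)
qed

lemma tetra_swap:
  assumes "k \<in> tetra_cells"
  shows "tetra_swap k \<in> tetra_cells" "tetra_swap (tetra_swap k) = k"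
proof -
  consider (c) j where "k = (\<lambda>i. if i = j then 3 else 0)" | (m) j where "k = (\<lambda>i. if i = j then 0 else 1)"
    | (o) "\<not> corner k" "\<not> mid_face k"
    using corner_cases[OF assms] mid_face_cases[OF assms] by blast
  then have "tetra_swap k \<in> tetra_cells \<and> tetra_swap (tetra_swap k) = k"
  proof cases
    case o
    then show ?thesis
      using assms by (simp add: tetra_swap_def)
  qed (simp_all add: corner_swap)
  then show "tetra_swap k \<in> tetra_cells" "tetra_swap (tetra_swap k) = k"
    by auto
qed

lemma rigid_tetra_motion: "rigid_motion (tetra_motion k)"
  using rigid_motions(1)[of "- (s *\<^sub>R centre k)" for s] rigid_motions(1)[of 0]
    rigid_half_turn rigid_quarter_turn
  by (auto simp: tetra_motion_def)

lemma tetra_motion_cell: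
  assumes "k \<in> tetra_cells"
  shows "tetra_motion k ` cell k = cell (tetra_swap k)"
proof -
  have c: "(\<Sum>i\<in>UNIV. k i) = 3" if "corner k"
    using corner_cases[OF assms that] by (auto simp: sum_4) (metis exhaust_4)+
  have m: "(\<Sum>i\<in>UNIV. k i) = 3" if "mid_face k"
    using that by (simp add: mid_face_def)
  consider "corner k" | "\<not> corner k" "mid_face k" | "\<not> corner k" "\<not> mid_face k"
    by blast
  then show ?thesis
  proof cases
    case 1
    have "(4/3) * (of_int (k i) - of_int (\<Sum>j\<in>UNIV. k j) / 4) = real_of_int (k i - (1 - k i div 3))" for i
      unfolding c[OF 1] using corner_cases[OF assms 1] by auto
    from translate_cell[of "4/3" k "\<lambda>i. 1 - k i div 3", OF this]
    show ?thesis
      using 1 by (simp add: tetra_motion_def tetra_swap_def)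
  next
    case 2
    have "4 * (of_int (k i) - of_int (\<Sum>j\<in>UNIV. k j) / 4) = real_of_int (k i - (3 - 3 * k i))" for i
      unfolding m[OF 2(2)] by simp
    from translate_cell[of 4 k "\<lambda>i. 3 - 3 * k i", OF this]
    show ?thesis
      using 2 by (simp add: tetra_motion_def tetra_swap_def)
  next
    case 3
    then show ?thesis
      using half_turn_cell quarter_turn_cell by (simp add: tetra_motion_def tetra_swap_def)
  qed
qed

text \<open>Pulled back, an outer facet is a cut: a lower facet with positive entry, or an upper
  facet of an octahedron, whose level \<open>k j + 1\<close> is positive in any case.\<close>

lemma tetra_facet:
  assumes k: "k \<in> tetra_cells" and q: "q \<in> cell k" and i: "lev i (tetra_motion k q) = 0"
    and sk: "(\<Sum>i\<in>UNIV. tetra_swap k i) \<in> {2, 3}"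
    and p: "tetra_motion k q \<in> cell (tetra_swap k)"
  shows "\<exists>j. lev j q = of_int (k j) \<and> 1 \<le> k j \<and> (\<Sum>i\<in>UNIV. k i) = 3 \<or>
             lev j q = of_int (k j) + 1 \<and> (\<Sum>i\<in>UNIV. k i) = 2"
proof -
  have k0: "0 \<le> k j" for j
    using k by (auto simp: tetra_cells_def)
  have sk0: "tetra_swap k i = 0"
  proof -
    have "0 \<le> tetra_swap k i" "of_int (tetra_swap k i) \<le> lev i (tetra_motion k q)"
      using tetra_swap(1)[OF k] p by (auto simp: tetra_cells_def cell_def)
    then show ?thesis
      using i by simp
  qed
  consider (c) j where "k = (\<lambda>i. if i = j then 3 else 0)" | (m) j where "k = (\<lambda>i. if i = j then 0 else 1)"
    | (o) "\<not> corner k" "\<not> mid_face k"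
    using corner_cases[OF k] mid_face_cases[OF k] by blast
  then show ?thesis
  proof cases
    case (c j)
    have s: "(\<Sum>i\<in>UNIV. k i) = 3"
      using exhaust_4[of j] by (auto simp: c sum_4)
    \<comment> \<open>The target is a middle cell with its only zero entry at \<open>j\<close>; its
      outer facet comes from the plane \<open>lev j = 3\<close> that cuts off the corner.\<close>
    have "i = j"
      using sk0 by (auto simp: c corner_swap split: if_splits)
    then have "lev i q = of_int (k i) \<and> 1 \<le> k i"
      using i unfolding tetra_motion_def lev_translate by (simp add: c corner_swap lev_translate s[unfolded c])
    then show ?thesis
      using s by blast
  next
    case (m j)
    have s: "(\<Sum>i\<in>UNIV. k i) = 3"
      using exhaust_4[of j] by (auto simp: m sum_4)
    \<comment> \<open>The target is a corner, whose three outer facets come from the planes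
      \<open>lev i = 1\<close> bounding the middle cell.\<close>
    have "i \<noteq> j"
      using sk0 by (auto simp: m corner_swap split: if_splits)
    then have "lev i q = of_int (k i) \<and> 1 \<le> k i"
      using i unfolding tetra_motion_def lev_translate by (simp add: m corner_swap lev_translate s[unfolded m])
    then show ?thesis
      using s by blast
  next
    case o
    then have sw: "tetra_swap k = k"
      by (simp add: tetra_swap_def)
    have ki: "k i = 0"
      using sk0 sw by simp
    show ?thesis
    proof (cases "(\<Sum>i\<in>UNIV. k i) = 3")
      case True
      \<comment> \<open>Corners and middle cells being excluded, this leaves the edge tetrahedra, to
        which the fact \<open>half_turn_index\<close> applies.\<close>
      have "k j \<le> 2" for j
      proof (rule ccontr)
        assume "\<not> k j \<le> 2"
        moreover have "k j \<noteq> 3"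
          using o by (auto simp: corner_def)
        moreover have "k j \<le> 3"
          using True k0[of 1] k0[of 2] k0[of 3] k0[of 4] exhaust_4[of j] by (auto simp: sum_4)
        ultimately show False
          by simp
      qed
      then have "k (half_turn_index k i) \<noteq> 0"
        using half_turn_index[of k i] k0 o True ki unfolding mid_face_def by blast
      then have "1 \<le> k (half_turn_index k i)"
        using k0[of "half_turn_index k i"] by simp
      moreover have "lev (half_turn_index k i) q = of_int (k (half_turn_index k i))"
        using lev_half_turn[of i k q] i ki o True by (simp add: tetra_motion_def)
      ultimately show ?thesis
        using True by blast
    next
      case False
      then have s: "(\<Sum>i\<in>UNIV. k i) = 2"
        using sk sw by auto
      have "lev (quarter_turn_index i) q = of_int (k (quarter_turn_index i)) + 1"
        using lev_quarter_turn[OF s, of i q] i ki o s by (simp add: tetra_motion_def)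
      then show ?thesis
        using s by blast
    qed
  qed
qed

lemma tetra_dissects: "\<exists>D. dissects D tetra"
proof (rule honeycomb_dissects[where K = tetra_cells and g = tetra_motion and \<sigma> = tetra_swap])
  show fin: "finite tetra_cells"
  proof (rule finite_subset[OF _ finite_int_valued[of 3]], safe)
    fix k i assume "k \<in> tetra_cells"
    then have "0 \<le> k 1" "0 \<le> k 2" "0 \<le> k 3" "0 \<le> k 4" "k 1 + k 2 + k 3 + k 4 \<le> 3"
      by (auto simp: tetra_cells_def sum_4)
    then show "k i \<in> {0..3}"
      using exhaust_4[of i] by auto
  qed
  fix p assume p: "p \<in> frontier tetra"
  have "closed tetra"
    unfolding tetra_eq using fin polytope_imp_closed[OF polytope_cell] by blast
  then have p_tetra: "p \<in> tetra"
    using p frontier_subset_closed by blast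
  have "p \<notin> interior tetra"
    using p by (simp add: frontier_def)
  then obtain i where "\<not> 0 < lev i p"
    using interior_tetra by blast
  moreover have "0 \<le> lev i p"
    using p_tetra by (simp add: tetra_def)
  ultimately have i: "lev i p = 0"
    by linarith
  obtain l where l: "l \<in> tetra_cells" "p \<in> cell l" "(\<Sum>i\<in>UNIV. l i) \<in> {2, 3}"
    using tetra_cover[OF p_tetra] i by blast
  \<comment> \<open>The cell that is moved onto \<open>cell l\<close>, since
    \<open>tetra_swap\<close> is its own inverse.\<close>
  define k where "k = tetra_swap l"
  have k: "k \<in> tetra_cells" "tetra_swap k = l"
    using tetra_swap[OF l(1)] by (auto simp: k_def)
  obtain q where q: "q \<in> cell k" "p = tetra_motion k q"
    using l(2) tetra_motion_cell[OF k(1)] k(2) by blast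
  have k0: "0 \<le> k j" for j
    using k(1) by (auto simp: tetra_cells_def)
  obtain j where "lev j q = of_int (k j) \<and> 1 \<le> k j \<and> (\<Sum>i\<in>UNIV. k i) = 3 \<or>
             lev j q = of_int (k j) + 1 \<and> (\<Sum>i\<in>UNIV. k i) = 2"
    using tetra_facet[OF k(1) q(1), of i] i l q k(2) by auto
  then have "\<exists>c\<in>cell k \<inter> interior tetra. lev j q = of_int (k j) \<and> lev j c = of_int (k j) \<or>
       lev j q = of_int (k j) + 1 \<and> lev j c = of_int (k j) + 1"
  proof (elim disjE conjE)
    assume j: "lev j q = of_int (k j)" "1 \<le> k j" "(\<Sum>i\<in>UNIV. k i) = 3"
    obtain c where c: "c \<in> cell k" "lev j c = of_int (k j)"
      "\<And>i. i \<noteq> j \<Longrightarrow> of_int (k i) < lev i c \<and> lev i c < of_int (k i) + 1"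
      using lower_facet[of k j] j(3) by auto
    \<comment> \<open>Level \<open>j\<close> is positive by the choice of the facet; the others lie
      strictly above nonnegative entries.\<close>
    have "0 < lev i c" for i
      using c(2) c(3)[of i] k0[of i] j(2) by (cases "i = j") (auto intro: le_less_trans[rotated])
    then show ?thesis
      using c(1,2) j(1) interior_tetra by blast
  next
    assume j: "lev j q = of_int (k j) + 1" "(\<Sum>i\<in>UNIV. k i) = 2"
    obtain c where c: "c \<in> cell k" "lev j c = of_int (k j) + 1"
      "\<And>i. i \<noteq> j \<Longrightarrow> of_int (k i) < lev i c \<and> lev i c < of_int (k i) + 1"
      using upper_facet[of k j] j(2) by auto
    have "0 < lev i c" for i
      using c(2) c(3)[of i] k0[of i] by (cases "i = j") (auto intro: le_less_trans[rotated])
    then show ?thesis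
      using c(1,2) j(1) interior_tetra by blast
  qed
  then show "\<exists>k\<in>tetra_cells. \<exists>q\<in>cell k. \<exists>c\<in>cell k \<inter> interior tetra. \<exists>i. p = tetra_motion k q \<and>
      (lev i q = of_int (k i) \<and> lev i c = of_int (k i) \<or>
       lev i q = of_int (k i) + 1 \<and> lev i c = of_int (k i) + 1)"
    using k(1) q by blast
qed (simp_all add: tetra_eq[symmetric] convex_tetra rigid_tetra_motion tetra_motion_cell
    tetra_swap, simp add: tetra_cells_def)

section \<open>Regular solids as similar images\<close>

lemma convex_combination_4:
  fixes y :: "4 \<Rightarrow> point3"
  assumes "convex C" "\<And>i. 0 \<le> a i" "(\<Sum>i\<in>UNIV. a i) = 1" "\<And>i. y i \<in> C"
  shows "(\<Sum>i\<in>UNIV. a i *\<^sub>R y i) \<in> C"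
  using assms by (intro convex_sum) auto

text \<open>The numbers \<open>lev i x / 4\<close> are the barycentric coordinates of
  \<open>x\<close>.\<close>

lemma tetra_hull: "tetra = convex hull (range facet_normal)"
proof
  show "tetra \<subseteq> convex hull (range facet_normal)"
  proof
    fix x assume x: "x \<in> tetra"
    have "(\<Sum>i\<in>UNIV. (lev i x / 4) *\<^sub>R facet_normal i) \<in> convex hull (range facet_normal)"
    proof (rule convex_combination_4)
      show "0 \<le> lev i x / 4" for i
        using x by (simp add: tetra_def)
      show "(\<Sum>i\<in>UNIV. lev i x / 4) = 1"
        using sum_lev[of x] by (simp flip: sum_divide_distrib)
    qed (auto intro: hull_inc)
    also have "(\<Sum>i\<in>UNIV. (lev i x / 4) *\<^sub>R facet_normal i) = x"
      by (simp add: vec_eq_iff forall_3 sum_4 facet_normal_def lev_simps) argo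
    finally show "x \<in> convex hull (range facet_normal)" .
  qed
  show "convex hull (range facet_normal) \<subseteq> tetra"
  proof (rule hull_minimal)
    have "facet_normal i \<in> tetra" for i
      by (auto simp: tetra_def facet_normal_def forall_4 lev_simps)
    then show "range facet_normal \<subseteq> tetra"
      by auto
  qed (rule convex_tetra)
qed

definition octa_vertices :: "point3 set" where
  "octa_vertices = {vector [1, 0, 0], vector [-1, 0, 0], vector [0, 1, 0], vector [0, -1, 0],
     vector [0, 0, 1], vector [0, 0, -1]}"

lemma octa_hull: "octa = convex hull octa_vertices"
proof
  show "octa \<subseteq> convex hull octa_vertices"
  proof
    fix x assume x: "x \<in> octa"
    let ?H = "convex hull octa_vertices"
    have H: "y \<in> ?H" if "y \<in> octa_vertices" for y
      using that by (rule hull_inc)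
    \<comment> \<open>Each absolute coordinate weights the vertex on the side of \<open>x\<close>;
      the remaining weight goes to the origin, the midpoint of two opposite vertices.\<close>
    define a where "a = (\<lambda>i::4. if i = 1 then \<bar>x$1\<bar> else if i = 2 then \<bar>x$2\<bar>
      else if i = 3 then \<bar>x$3\<bar> else 1 - \<bar>x$1\<bar> - \<bar>x$2\<bar> - \<bar>x$3\<bar>)"
    define y :: "4 \<Rightarrow> point3" where "y = (\<lambda>i. if i = 1 then vector [if x$1 \<ge> 0 then 1 else -1, 0, 0]
      else if i = 2 then vector [0, if x$2 \<ge> 0 then 1 else -1, 0]
      else if i = 3 then vector [0, 0, if x$3 \<ge> 0 then 1 else -1] else 0)"
    have "(1/2) *\<^sub>R vector [1, 0, 0] + (1/2) *\<^sub>R vector [-1, 0, 0] \<in> ?H"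
      by (rule convexD[OF convex_convex_hull H H]) (auto simp: octa_vertices_def)
    also have "(1/2) *\<^sub>R vector [1, 0, 0] + (1/2) *\<^sub>R vector [-1, 0, 0] = (0 :: point3)"
      by (simp add: vec_eq_iff forall_3)
    finally have "y i \<in> ?H" for i
      using exhaust_4[of i] by (auto simp: y_def intro!: H) (auto simp: octa_vertices_def)
    \<comment> \<open>The eight inequalities defining \<open>octa\<close> are the sign choices of
      this one.\<close>
    moreover have "\<bar>x$1\<bar> + \<bar>x$2\<bar> + \<bar>x$3\<bar> \<le> 1"
      using x by (auto simp: octa_def forall_4 lev_simps abs_if)
    then have "0 \<le> a i" for i
      by (auto simp: a_def)
    moreover have "(\<Sum>i\<in>UNIV. a i) = 1"
      by (simp add: sum_4 a_def)
    ultimately have "(\<Sum>i\<in>UNIV. a i *\<^sub>R y i) \<in> ?H"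
      by (intro convex_combination_4) auto
    also have "(\<Sum>i\<in>UNIV. a i *\<^sub>R y i) = x"
      by (simp add: vec_eq_iff forall_3 sum_4 a_def y_def)
    finally show "x \<in> ?H" .
  qed
  show "convex hull octa_vertices \<subseteq> octa"
  proof (rule hull_minimal)
    show "octa_vertices \<subseteq> octa"
      by (auto simp: octa_vertices_def octa_def forall_4 lev_simps)
  qed (rule convex_octa)
qed

text \<open>Divided by \<open>r\<close> the frame is orthonormal, so the affine map is a similarity
  of ratio \<open>r\<close>. The frame may have either orientation, since conjugation keeps the
  motions proper.\<close>

lemma dissects_frame:
  fixes m u v w :: point3
  assumes r: "norm u = r" "norm v = r" "norm w = r" "r > 0"
    and orth: "u \<bullet> v = 0" "u \<bullet> w = 0" "v \<bullet> w = 0"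
    and V: "\<exists>D. dissects D (convex hull V)"
  shows "\<exists>D. dissects D (convex hull ((\<lambda>x. m + x$1 *\<^sub>R u + x$2 *\<^sub>R v + x$3 *\<^sub>R w) ` V))"
proof -
  define M :: "real^3^3" where "M = (1 / r) *\<^sub>R transpose (vector [u, v, w])"
  have sq: "u \<bullet> u = r * r" "v \<bullet> v = r * r" "w \<bullet> w = r * r"
    using r by (simp_all add: dot_square_norm power2_eq_square)
  have "transpose M ** M = mat 1"
    using sq orth r(4)
    by (simp add: vec_eq_iff forall_3 M_def transpose_def matrix_matrix_mult_def mat_def sum_3
        inner_vec_def field_simps)
  then have M: "orthogonal_matrix M"
    by (simp add: orthogonal_matrix)
  have "m + r *\<^sub>R (M *v x) = m + x$1 *\<^sub>R u + x$2 *\<^sub>R v + x$3 *\<^sub>R w" for x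
    using r(4) by (simp add: vec_eq_iff M_def transpose_def matrix_vector_mult_def sum_3 field_simps)
  then have eq: "(\<lambda>x. m + x$1 *\<^sub>R u + x$2 *\<^sub>R v + x$3 *\<^sub>R w) = (\<lambda>x. m + r *\<^sub>R (M *v x))"
    by auto
  obtain D where "dissects D (convex hull V)"
    using V by blast
  then show ?thesis
    unfolding eq using dissects_similarity[OF _ M] similarity_image(6)[OF M] r(4) by simp
qed

section \<open>Regular solids in general position\<close>

lemma regular_octahedron_dissects:
  assumes "regular_octahedron R"
  shows "\<exists>D. dissects D R"
proof -
  obtain m u v w where f: "norm u > 0" "norm v = norm u" "norm w = norm u"
      "u \<bullet> v = 0" "u \<bullet> w = 0" "v \<bullet> w = 0"
    and R: "R = convex hull {m + u, m - u, m + v, m - v, m + w, m - w}"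
    using assms unfolding regular_octahedron_def by blast
  have "(\<lambda>x. m + x$1 *\<^sub>R u + x$2 *\<^sub>R v + x$3 *\<^sub>R w) ` octa_vertices =
      {m + u, m - u, m + v, m - v, m + w, m - w}"
    by (simp add: octa_vertices_def)
  then show ?thesis
    using dissects_frame[of u "norm u" v w octa_vertices m] octa_dissects f
    by (simp add: R octa_hull)
qed

lemma regular_tetrahedron_dissects:
  assumes "regular_tetrahedron T"
  shows "\<exists>D. dissects D T"
proof -
  obtain a b c d s where s: "s > 0" and T: "T = convex hull {a, b, c, d}"
    and dist: "dist a b = s" "dist a c = s" "dist a d = s" "dist b c = s" "dist b d = s" "dist c d = s"
    using assms unfolding regular_tetrahedron_def by blast
  \<comment> \<open>The tetrahedron is inscribed in a cube with centre \<open>m\<close> and half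
    edges \<open>u\<close>, \<open>v\<close>, \<open>w\<close>: its vertices are
    \<open>m + u + v + w\<close>, \<open>m + u - v - w\<close>, \<open>m - u + v - w\<close>,
    \<open>m - u - v + w\<close>. The definitions solve this system.\<close>
  define m where "m = (1/4) *\<^sub>R (a + b + c + d)"
  define u where "u = (1/4) *\<^sub>R (a + b - c - d)"
  define v where "v = (1/4) *\<^sub>R (a - b + c - d)"
  define w where "w = (1/4) *\<^sub>R (a - b - c + d)"
  have sq: "x \<bullet> x + y \<bullet> y - 2 * (x \<bullet> y) = s\<^sup>2" if "dist x y = s" for x y :: point3
    unfolding that[symmetric] dist_norm power2_norm_eq_inner
    by (simp add: inner_diff_left inner_diff_right inner_commute)
  note sqs = dist[THEN sq]
  note expand = u_def v_def w_def inner_add_left inner_add_right inner_diff_left inner_diff_right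
    inner_scaleR_left inner_scaleR_right inner_commute[of b a] inner_commute[of c a]
    inner_commute[of d a] inner_commute[of c b] inner_commute[of d b] inner_commute[of d c]
  \<comment> \<open>Up to the factor 1/16, each product is the difference of the squared lengths of
    two opposite edges.\<close>
  have "u \<bullet> v = 0" "u \<bullet> w = 0" "v \<bullet> w = 0"
    using sqs unfolding expand by argo+
  moreover have "u \<bullet> u = s\<^sup>2 / 8" "v \<bullet> v = s\<^sup>2 / 8" "w \<bullet> w = s\<^sup>2 / 8"
    using sqs unfolding expand by argo+
  then have "norm v = norm u" "norm w = norm u" "norm u > 0"
    using s by (simp_all only: norm_eq_sqrt_inner real_sqrt_gt_0_iff) simp
  moreover have "(\<lambda>x. m + x$1 *\<^sub>R u + x$2 *\<^sub>R v + x$3 *\<^sub>R w) ` range facet_normal = {a, b, c, d}"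
  proof -
    have "range facet_normal = {facet_normal 1, facet_normal 2, facet_normal 3, facet_normal 4}"
      by (simp add: UNIV_4)
    moreover have "m + u + v + w = a" "m + u - v - w = b" "m - u + v - w = c" "m - u - v + w = d"
      by (simp_all add: vec_eq_iff m_def u_def v_def w_def field_simps)
    ultimately show ?thesis
      by (simp add: facet_normal_def)
  qed
  ultimately show ?thesis
    using dissects_frame[of u "norm u" v w "range facet_normal" m] tetra_dissects
    by (simp add: T tetra_hull)
qed

theorem theorem1:
  fixes P :: "(real^3) set"
  assumes "solid_polyhedron P"
    and "\<exists>k Q. decomposition P k Q \<and>
           (\<forall>i<k. regular_tetrahedron (Q i) \<or> regular_octahedron (Q i))"
  shows "inside_out_dissectable P"
proof -
  obtain k Q where "decomposition P k Q" "\<And>i. i < k \<Longrightarrow> \<exists>D. dissects D (Q i)"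
    using assms(2) regular_tetrahedron_dissects regular_octahedron_dissects by metis
  then show ?thesis
    using dissects_decomposition dissects_imp_inside_out_dissectable by blast
qed

end
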